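(* Let $\Omega\subset\mathbb{R}^d$ be a compact set which is the closure of a non-empty convex open set, let $V:[0,+\infty[\to[0,+\infty[$ be a $C^2$ increasing function, and let $\mu\in\mathcal{P}(\Omega)$. If $\nu\in\mathcal{P}(\Omega)$ is a minimizer over $\mathcal{P}(\Omega)$ of the functional $$\mathfrak{F}^{\mu}(\nu)=\frac12 W_2^2(\mu,\nu)+\int_{\Omega\times\Omega}V(|x-y|^2)\,\nu(dx)\,\nu(dy),$$ then there exist a Kantorovich potential $\psi$ for the transport from $\nu$ to $\mu$ and a constant $m\in\mathbb{R}$ such that $$\psi+T_\nu\ge m\ \text{ on }\Omega,\qquad \psi+T_\nu=m\quad \nu\text{-a.e.},$$ where $T_\nu(x)=\int_\Omega 2V(|x-y|^2)\,\nu(dy)$.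
   Context: $\mathcal{P}(\Omega)$ is the set of Borel probability measures on $\Omega$, and $W_2$ is the 2-Wasserstein distance: $W_2^2(\mu,\nu)=\min\{\int_{\Omega\times\Omega}|x-y|^2\,d\gamma\}$ over all $\gamma\in\mathcal{P}(\Omega\times\Omega)$ with marginals $\mu$ and $\nu$. Set $c(x,y)=\frac12|x-y|^2$. For $\chi:\Omega\to\overline{\mathbb{R}}$ its $c$-transform is $\chi^c(y)=\inf_{x\in\Omega}\big(c(x,y)-\chi(x)\big)$. A function $\psi$ on $\Omega$ is $c$-concave if $\psi=\chi^c$ for some $\chi$. A Kantorovich potential for the transport from $\nu$ to $\mu$ is a $c$-concave function $\psi$ attaining the maximum of $\int_\Omega\psi\,d\nu+\int_\Omega\psi^c\,d\mu$ among $c$-concave functions; the maximal value is $\frac12W_2^2(\mu,\nu)$. *)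

theory Defs
  imports "HOL-Probability.Probability"
begin

definition borel_probs :: "'a::topological_space set \<Rightarrow> 'a measure set" where
  "borel_probs \<Omega> = {\<mu>. prob_space \<mu> \<and> sets \<mu> = sets (restrict_space borel \<Omega>)}"

definition couplings ::
  "'a::euclidean_space set \<Rightarrow> 'a measure \<Rightarrow> 'a measure \<Rightarrow> ('a \<times> 'a) measure set" where
  "couplings \<Omega> \<mu> \<nu> = {\<gamma> \<in> borel_probs (\<Omega> \<times> \<Omega>).
     distr \<gamma> (restrict_space borel \<Omega>) fst = \<mu> \<and> distr \<gamma> (restrict_space borel \<Omega>) snd = \<nu>}"

(* The infimum is a minimum: for compact \<Omega> and \<mu>, \<nu> in borel_probs \<Omega>, the set of
   couplings is non-empty (product measure), all the integrands are bounded, and the infimum is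
   attained. *)
definition W2 :: "'a::euclidean_space set \<Rightarrow> 'a measure \<Rightarrow> 'a measure \<Rightarrow> real" where
  "W2 \<Omega> \<mu> \<nu> = sqrt (INF \<gamma>\<in>couplings \<Omega> \<mu> \<nu>. \<integral>p. (norm (fst p - snd p))\<^sup>2 \<partial>\<gamma>)"

definition cost :: "'a::euclidean_space \<Rightarrow> 'a \<Rightarrow> real" where
  "cost x y = (norm (x - y))\<^sup>2 / 2"

definition c_transform :: "'a::euclidean_space set \<Rightarrow> ('a \<Rightarrow> ereal) \<Rightarrow> 'a \<Rightarrow> ereal" where
  "c_transform \<Omega> \<phi> y = (INF x\<in>\<Omega>. ereal (cost x y) - \<phi> x)"

definition c_concave :: "'a::euclidean_space set \<Rightarrow> ('a \<Rightarrow> ereal) \<Rightarrow> bool" where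
  "c_concave \<Omega> \<psi> \<longleftrightarrow> (\<exists>\<phi>. \<forall>y\<in>\<Omega>. \<psi> y = c_transform \<Omega> \<phi> y)"

(* On a non-empty compact \<Omega> a c-concave function is either real-valued or constantly \<infinity> or
   constantly -\<infinity>. In the two constant cases the dual functional would be of the form
   \<infinity> - \<infinity>, so the dual problem is posed over real-valued c-concave functions. The c-transform of
   such a function is finite on \<Omega>, so real_of_ereal only changes the type there. *)
definition dual_functional ::
  "'a::euclidean_space set \<Rightarrow> 'a measure \<Rightarrow> 'a measure \<Rightarrow> ('a \<Rightarrow> real) \<Rightarrow> real" where
  "dual_functional \<Omega> \<nu> \<mu> \<psi> =
     (\<integral>x. \<psi> x \<partial>\<nu>) + (\<integral>y. real_of_ereal (c_transform \<Omega> (\<lambda>x. ereal (\<psi> x)) y) \<partial>\<mu>)"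

definition Kantorovich_potential ::
  "'a::euclidean_space set \<Rightarrow> 'a measure \<Rightarrow> 'a measure \<Rightarrow> ('a \<Rightarrow> real) \<Rightarrow> bool" where
  "Kantorovich_potential \<Omega> \<nu> \<mu> \<psi> \<longleftrightarrow>
     is_arg_max (dual_functional \<Omega> \<nu> \<mu>) (\<lambda>\<phi>. c_concave \<Omega> (\<lambda>x. ereal (\<phi> x))) \<psi>"

(* At an endpoint of an interval S the derivatives are one-sided. *)
definition C2_on :: "real set \<Rightarrow> (real \<Rightarrow> real) \<Rightarrow> bool" where
  "C2_on S f \<longleftrightarrow> (\<exists>f' f''.
     (\<forall>t\<in>S. (f has_real_derivative f' t) (at t within S)) \<and>
     (\<forall>t\<in>S. (f' has_real_derivative f'' t) (at t within S)) \<and>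
     continuous_on S f'')"

definition F_functional ::
  "'a::euclidean_space set \<Rightarrow> (real \<Rightarrow> real) \<Rightarrow> 'a measure \<Rightarrow> 'a measure \<Rightarrow> real" where
  "F_functional \<Omega> V \<mu> \<nu> =
     (W2 \<Omega> \<mu> \<nu>)\<^sup>2 / 2 + (\<integral>p. V ((norm (fst p - snd p))\<^sup>2) \<partial>(\<nu> \<Otimes>\<^sub>M \<nu>))"

definition T_pot :: "(real \<Rightarrow> real) \<Rightarrow> 'a::euclidean_space measure \<Rightarrow> 'a \<Rightarrow> real" where
  "T_pot V \<nu> x = (\<integral>y. 2 * V ((norm (x - y))\<^sup>2) \<partial>\<nu>)"

end

theory Submission
  imports Defs
begin

text \<open>
  Write \<open>T\<close> for \<open>T_pot V \<nu>\<close> and \<open>W(\<rho>)\<close> for half the squared distance from \<open>\<mu>\<close> to \<open>\<rho>\<close>. Comparing \<open>\<nu>\<close> with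
  the mixtures \<open>(1 - t) \<nu> + t \<rho>\<close> as \<open>t\<close> tends to \<open>0\<close> shows that \<open>\<nu>\<close> also minimizes the linearized
  functional \<open>G(\<rho>) = W(\<rho>) + \<integral> T d\<rho>\<close> (lemma \<open>minimizer_linearized\<close>); this uses the convexity of \<open>W\<close>,
  which comes from mixing couplings, and the fact that the interaction energy is a quadratic form.

  The infimum of \<open>G\<close> can be computed directly. When \<open>\<rho>\<close> is free, a transport plan is only
  constrained by its marginal \<open>\<mu>\<close>, so each point \<open>x\<close> may be sent to a point \<open>y\<close> that almost minimizes
  \<open>c(x, y) + T y\<close>. Hence \<open>G(\<nu>) \<le> \<integral> \<phi> d\<mu>\<close>, where \<open>\<phi>\<close> is the \<open>c\<close>-transform of \<open>- T\<close>
  (lemma \<open>approx_optimal_target\<close>).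

  Let \<open>\<psi> = \<phi>\<^sup>c\<close>, the double transform of \<open>- T\<close>. Then \<open>\<psi> + T \<ge> 0\<close> and \<open>\<psi>\<^sup>c \<ge> \<phi>\<close> hold pointwise, so
  \<open>\<integral> \<psi> d\<nu> + \<integral> \<psi>\<^sup>c d\<mu> \<ge> \<integral> \<phi> d\<mu> - \<integral> T d\<nu> \<ge> W(\<nu>)\<close>. By weak duality (lemma \<open>weak_duality\<close>) no
  \<open>c\<close>-concave function has a dual value above \<open>W(\<nu>)\<close>, so \<open>\<psi>\<close> is a Kantorovich potential. Weak duality
  for \<open>\<psi>\<close> gives moreover \<open>\<integral> \<psi> d\<nu> \<le> W(\<nu>) - \<integral> \<phi> d\<mu> \<le> - \<integral> T d\<nu>\<close>, and a nonnegative function with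
  nonpositive integral vanishes almost everywhere: \<open>\<psi> + T = 0\<close> holds \<open>\<nu>\<close>-almost everywhere, so the
  constant \<open>m = 0\<close> works.
\<close>

section \<open>Probability measures on a compact set\<close>

lemma borel_probsD:
  assumes "\<mu> \<in> borel_probs \<Omega>"
  shows "prob_space \<mu>" "sets \<mu> = sets (restrict_space borel \<Omega>)" "space \<mu> = \<Omega>"
proof -
  show "prob_space \<mu>" and s: "sets \<mu> = sets (restrict_space borel \<Omega>)"
    using assms by (auto simp: borel_probs_def)
  show "space \<mu> = \<Omega>"
    using sets_eq_imp_space_eq[OF s] by (simp add: space_restrict_space)
qed

lemma distr_borel_probs:
  assumes "\<mu> \<in> borel_probs \<Omega>" and "f \<in> measurable (restrict_space borel \<Omega>) (restrict_space borel \<Omega>')"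
  shows "distr \<mu> (restrict_space borel \<Omega>') f \<in> borel_probs \<Omega>'"
  using assms prob_space.prob_space_distr[of \<mu> f "restrict_space borel \<Omega>'"]
  by (auto simp: borel_probs_def cong: measurable_cong_sets)

lemma continuous_bounded_on:
  fixes f :: "'a::topological_space \<Rightarrow> real"
  assumes "compact \<Omega>" "continuous_on \<Omega> f"
  obtains B where "\<And>x. x \<in> \<Omega> \<Longrightarrow> \<bar>f x\<bar> \<le> B"
  using compact_imp_bounded[OF compact_continuous_image[OF assms(2,1)]] by (auto simp: bounded_iff)

lemma continuous_measurable_integrable:
  fixes f :: "'a::topological_space \<Rightarrow> real"
  assumes "\<mu> \<in> borel_probs \<Omega>" and "compact \<Omega>" and "continuous_on \<Omega> f"
  shows "f \<in> borel_measurable \<mu>" and "integrable \<mu> f"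
proof -
  interpret prob_space \<mu> using borel_probsD[OF assms(1)] by simp
  show meas: "f \<in> borel_measurable \<mu>"
    using borel_measurable_continuous_on_restrict[OF assms(3)] borel_probsD(2)[OF assms(1)]
    by (simp cong: measurable_cong_sets)
  obtain B where "\<And>x. x \<in> \<Omega> \<Longrightarrow> \<bar>f x\<bar> \<le> B"
    using continuous_bounded_on[OF assms(2,3)] by blast
  then show "integrable \<mu> f"
    using meas borel_probsD(3)[OF assms(1)] by (intro integrable_const_bound[of _ B]) auto
qed

text \<open>The product \<open>\<sigma>\<close>-algebra of the two traces contains the trace of the Borel sets of the product;
  measurability with respect to the latter therefore transfers to product measures.\<close>

lemma measurable_id_pair_restrict:
  fixes \<Omega> :: "'a::second_countable_topology set" and \<Omega>' :: "'b::second_countable_topology set"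
  shows "(\<lambda>p. p) \<in> measurable (restrict_space borel \<Omega> \<Otimes>\<^sub>M restrict_space borel \<Omega>')
           (restrict_space borel (\<Omega> \<times> \<Omega>'))"
proof (rule measurable_restrict_space2)
  have "(\<lambda>p. (fst p, snd p)) \<in> measurable (restrict_space borel \<Omega> \<Otimes>\<^sub>M restrict_space borel \<Omega>')
      (borel \<Otimes>\<^sub>M borel)"
    by (intro measurable_Pair measurable_compose[OF measurable_fst] measurable_compose[OF measurable_snd]
        measurable_restrict_space1) auto
  then show "(\<lambda>p. p) \<in> measurable (restrict_space borel \<Omega> \<Otimes>\<^sub>M restrict_space borel \<Omega>') borel"
    by (simp add: borel_prod)
qed (auto simp: space_pair_measure space_restrict_space)

lemma measurable_fst_restrict:
  "fst \<in> measurable (restrict_space borel (\<Omega> \<times> \<Omega>')) (restrict_space borel \<Omega>)"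
  by (intro measurable_restrict_space3 borel_measurable_continuous_onI continuous_intros) auto

lemma measurable_snd_restrict:
  "snd \<in> measurable (restrict_space borel (\<Omega> \<times> \<Omega>')) (restrict_space borel \<Omega>')"
  by (intro measurable_restrict_space3 borel_measurable_continuous_onI continuous_intros) auto

lemma pair_measurable:
  fixes k :: "'a::second_countable_topology \<times> 'b::second_countable_topology \<Rightarrow> real"
  assumes "continuous_on (\<Omega> \<times> \<Omega>') k"
    and "sets M = sets (restrict_space borel \<Omega>)" and "sets N = sets (restrict_space borel \<Omega>')"
  shows "k \<in> borel_measurable (M \<Otimes>\<^sub>M N)"
proof -
  have "k \<in> borel_measurable (restrict_space borel \<Omega> \<Otimes>\<^sub>M restrict_space borel \<Omega>')"
    using measurable_compose[OF measurable_id_pair_restrict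
        borel_measurable_continuous_on_restrict[OF assms(1)]] .
  then show ?thesis
    using assms(2,3) by (simp cong: measurable_cong_sets sets_pair_measure_cong)
qed

lemma bounded_kernel:
  fixes k :: "'a::topological_space \<times> 'a \<Rightarrow> real"
  assumes "compact \<Omega>" "continuous_on (\<Omega> \<times> \<Omega>) k"
  obtains B where "\<And>x y. x \<in> \<Omega> \<Longrightarrow> y \<in> \<Omega> \<Longrightarrow> \<bar>k (x, y)\<bar> \<le> B"
  using continuous_bounded_on[OF compact_Times[OF assms(1,1)] assms(2)] by (metis mem_Sigma_iff)

lemma kernel_integral_measurable_bounded:
  fixes k :: "'a::euclidean_space \<times> 'a \<Rightarrow> real"
  assumes "compact \<Omega>" "continuous_on (\<Omega> \<times> \<Omega>) k" "\<rho> \<in> borel_probs \<Omega>"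
  shows "(\<lambda>x. \<integral>y. k (x, y) \<partial>\<rho>) \<in> borel_measurable (restrict_space borel \<Omega>)"
    and "(\<And>x y. x \<in> \<Omega> \<Longrightarrow> y \<in> \<Omega> \<Longrightarrow> \<bar>k (x, y)\<bar> \<le> B) \<Longrightarrow> x \<in> \<Omega> \<Longrightarrow> \<bar>\<integral>y. k (x, y) \<partial>\<rho>\<bar> \<le> B"
proof -
  note \<rho> = borel_probsD[OF assms(3)]
  interpret prob_space \<rho> by (rule \<rho>)
  have "(\<lambda>(x, y). k (x, y)) \<in> borel_measurable (restrict_space borel \<Omega> \<Otimes>\<^sub>M \<rho>)"
    using pair_measurable[OF assms(2) refl \<rho>(2)] by simp
  then show "(\<lambda>x. \<integral>y. k (x, y) \<partial>\<rho>) \<in> borel_measurable (restrict_space borel \<Omega>)"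
    by (rule borel_measurable_lebesgue_integral)
  assume B: "\<And>x y. x \<in> \<Omega> \<Longrightarrow> y \<in> \<Omega> \<Longrightarrow> \<bar>k (x, y)\<bar> \<le> B" and x: "x \<in> \<Omega>"
  have int: "integrable \<rho> (\<lambda>y. k (x, y))"
    by (rule continuous_measurable_integrable(2)[OF assms(3,1)])
      (rule continuous_on_compose2[OF assms(2)], auto intro!: continuous_intros x)
  have "(\<integral>y. k (x, y) \<partial>\<rho>) \<le> B" "(\<integral>y. k (x, y) \<partial>\<rho>) \<ge> - B"
    using B[OF x] \<rho>(3) int
    by (auto intro!: integral_le_const integral_ge_const AE_I2 simp: abs_le_iff minus_le_iff)
  then show "\<bar>\<integral>y. k (x, y) \<partial>\<rho>\<bar> \<le> B" by linarith
qed

section \<open>Mixtures of two measures\<close>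

text \<open>The convex combination \<open>(1 - t) \<nu> + t \<rho>\<close>, obtained by first tossing a coin that shows heads with
  probability \<open>t\<close>. This form makes integrals and image measures of mixtures instances of the laws of
  the Giry monad.\<close>

definition mixture :: "real \<Rightarrow> 'a measure \<Rightarrow> 'a measure \<Rightarrow> 'a measure" where
  "mixture t \<nu> \<rho> = measure_pmf (bernoulli_pmf t) \<bind> (\<lambda>b. if b then \<rho> else \<nu>)"

lemma mixture_kernel:
  assumes "prob_space \<nu>" "prob_space \<rho>" "sets \<nu> = sets K" "sets \<rho> = sets K"
  shows "(\<lambda>b. if b then \<rho> else \<nu>) \<in> measurable (measure_pmf (bernoulli_pmf t)) (subprob_algebra K)"
  using assms by (auto simp: measurable_def space_subprob_algebra prob_space_imp_subprob_space)

lemma mixture_borel_probs: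
  assumes "\<nu> \<in> borel_probs \<Omega>" "\<rho> \<in> borel_probs \<Omega>"
  shows "mixture t \<nu> \<rho> \<in> borel_probs \<Omega>"
proof -
  note \<nu> = borel_probsD[OF assms(1)] and \<rho> = borel_probsD[OF assms(2)]
  note K = mixture_kernel[OF \<nu>(1) \<rho>(1) \<nu>(2) \<rho>(2), of t]
  have "prob_space (mixture t \<nu> \<rho>)"
    unfolding mixture_def
    by (rule prob_space.prob_space_bind[OF _ _ K]) (auto simp: \<nu> \<rho> prob_space_measure_pmf)
  moreover have "sets (mixture t \<nu> \<rho>) = sets (restrict_space borel \<Omega>)"
    unfolding mixture_def by (rule sets_bind) (auto simp: \<nu> \<rho>)
  ultimately show ?thesis by (simp add: borel_probs_def)
qed

lemma integral_mixture:
  fixes f :: "'a::topological_space \<Rightarrow> real"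
  assumes "\<nu> \<in> borel_probs \<Omega>" "\<rho> \<in> borel_probs \<Omega>" and t: "0 \<le> t" "t \<le> 1"
    and f: "f \<in> borel_measurable (restrict_space borel \<Omega>)" "\<And>x. x \<in> \<Omega> \<Longrightarrow> \<bar>f x\<bar> \<le> B"
  shows "(\<integral>x. f x \<partial>mixture t \<nu> \<rho>) = (1 - t) * (\<integral>x. f x \<partial>\<nu>) + t * (\<integral>x. f x \<partial>\<rho>)"
proof -
  note \<nu> = borel_probsD[OF assms(1)] and \<rho> = borel_probsD[OF assms(2)]
  note K = mixture_kernel[OF \<nu>(1) \<rho>(1) \<nu>(2) \<rho>(2), of t]
  have "(\<integral>x. f x \<partial>mixture t \<nu> \<rho>)
      = (\<integral>b. (\<integral>x. f x \<partial>(if b then \<rho> else \<nu>)) \<partial>measure_pmf (bernoulli_pmf t))"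
    unfolding mixture_def
  proof (rule integral_bind[where B' = 1, OF f(1) _ K])
    show "\<bar>f x\<bar> \<le> B" if "x \<in> space (restrict_space borel \<Omega>)" for x
      using that f(2) by (auto simp: space_restrict_space)
    show "finite_measure (measure_pmf (bernoulli_pmf t))"
      by (rule prob_space.finite_measure) (rule prob_space_measure_pmf)
    show "AE b in measure_pmf (bernoulli_pmf t).
        emeasure (if b then \<rho> else \<nu>) (space (if b then \<rho> else \<nu>)) \<le> ennreal 1"
      using \<nu>(1) \<rho>(1) by (auto simp: prob_space.emeasure_space_1)
  qed
  then show ?thesis using t by (simp add: algebra_simps)
qed

lemma distr_mixture:
  assumes "\<nu> \<in> borel_probs \<Omega>" "\<rho> \<in> borel_probs \<Omega>"
    and "f \<in> measurable (restrict_space borel \<Omega>) R"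
  shows "distr (mixture t \<nu> \<rho>) R f = mixture t (distr \<nu> R f) (distr \<rho> R f)"
proof -
  note \<nu> = borel_probsD[OF assms(1)] and \<rho> = borel_probsD[OF assms(2)]
  note K = mixture_kernel[OF \<nu>(1) \<rho>(1) \<nu>(2) \<rho>(2), of t]
  show ?thesis
    unfolding mixture_def distr_bind[OF K _ assms(3), simplified]
    by (intro arg_cong2[where f = bind]) auto
qed

lemma mixture_self:
  assumes "\<nu> \<in> borel_probs \<Omega>"
  shows "mixture t \<nu> \<nu> = \<nu>"
proof -
  note \<nu> = borel_probsD[OF assms]
  have "mixture t \<nu> \<nu> = measure_pmf (bernoulli_pmf t) \<bind> (\<lambda>b. \<nu>)"
    unfolding mixture_def by simp
  also have "\<dots> = \<nu>"
    by (rule measure_eqI)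
      (auto simp: \<nu> emeasure_bind_const_prob_space prob_space_measure_pmf prob_space_imp_subprob_space)
  finally show ?thesis .
qed

section \<open>The Wasserstein distance\<close>

lemma couplingsD:
  assumes "\<gamma> \<in> couplings \<Omega> \<mu> \<nu>"
  shows "\<gamma> \<in> borel_probs (\<Omega> \<times> \<Omega>)"
    and "distr \<gamma> (restrict_space borel \<Omega>) fst = \<mu>" and "distr \<gamma> (restrict_space borel \<Omega>) snd = \<nu>"
  using assms by (auto simp: couplings_def)

lemma product_coupling:
  fixes \<mu> \<nu> :: "'a::euclidean_space measure"
  assumes "\<mu> \<in> borel_probs \<Omega>" "\<nu> \<in> borel_probs \<Omega>"
  shows "distr (\<mu> \<Otimes>\<^sub>M \<nu>) (restrict_space borel (\<Omega> \<times> \<Omega>)) (\<lambda>p. p) \<in> couplings \<Omega> \<mu> \<nu>"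
proof -
  note \<mu> = borel_probsD[OF assms(1)] and \<nu> = borel_probsD[OF assms(2)]
  interpret M: prob_space \<mu> by (rule \<mu>)
  interpret N: prob_space \<nu> by (rule \<nu>)
  interpret P: pair_prob_space \<mu> \<nu> ..
  have id: "(\<lambda>p. p) \<in> measurable (\<mu> \<Otimes>\<^sub>M \<nu>) (restrict_space borel (\<Omega> \<times> \<Omega>))"
    using measurable_id_pair_restrict \<mu>(2) \<nu>(2)
    by (simp cong: measurable_cong_sets sets_pair_measure_cong)
  have "distr (\<mu> \<Otimes>\<^sub>M \<nu>) (restrict_space borel \<Omega>) fst = distr (\<mu> \<Otimes>\<^sub>M \<nu>) \<mu> fst"
    by (rule distr_cong) (auto simp: \<mu>)
  moreover have "distr (\<mu> \<Otimes>\<^sub>M \<nu>) (restrict_space borel \<Omega>) snd = \<nu>"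
  proof (rule measure_eqI)
    fix A assume "A \<in> sets (distr (\<mu> \<Otimes>\<^sub>M \<nu>) (restrict_space borel \<Omega>) snd)"
    then have A: "A \<in> sets \<nu>" by (simp add: \<nu>)
    have "snd \<in> measurable (\<mu> \<Otimes>\<^sub>M \<nu>) (restrict_space borel \<Omega>)"
      using measurable_snd[of \<mu> \<nu>] \<nu>(2) by (simp cong: measurable_cong_sets)
    moreover have "snd -` A \<inter> space (\<mu> \<Otimes>\<^sub>M \<nu>) = space \<mu> \<times> A"
      using sets.sets_into_space[OF A] by (auto simp: space_pair_measure)
    ultimately show "emeasure (distr (\<mu> \<Otimes>\<^sub>M \<nu>) (restrict_space borel \<Omega>) snd) A = emeasure \<nu> A"
      using A by (simp add: emeasure_distr \<nu> N.emeasure_pair_measure_Times M.emeasure_space_1)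
  qed (simp add: \<nu>)
  ultimately show ?thesis
    using N.distr_pair_fst[of \<mu>] P.prob_space_distr[OF id]
    by (auto simp: couplings_def borel_probs_def comp_def
        distr_distr[OF measurable_fst_restrict id] distr_distr[OF measurable_snd_restrict id])
qed

lemma continuous_sq_dist:
  "continuous_on S (\<lambda>p::'a::euclidean_space \<times> 'a. (norm (fst p - snd p))\<^sup>2)"
  by (intro continuous_intros)

lemma W2_squared:
  fixes \<mu> \<nu> :: "'a::euclidean_space measure"
  assumes "\<mu> \<in> borel_probs \<Omega>" "\<nu> \<in> borel_probs \<Omega>"
  shows "(W2 \<Omega> \<mu> \<nu>)\<^sup>2 = (INF \<gamma>\<in>couplings \<Omega> \<mu> \<nu>. \<integral>p. (norm (fst p - snd p))\<^sup>2 \<partial>\<gamma>)"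
  unfolding W2_def using product_coupling[OF assms]
  by (intro real_sqrt_pow2 cINF_greatest) auto

lemma W2_le:
  fixes \<mu> \<nu> :: "'a::euclidean_space measure"
  assumes "\<mu> \<in> borel_probs \<Omega>" "\<nu> \<in> borel_probs \<Omega>" and "\<gamma> \<in> couplings \<Omega> \<mu> \<nu>"
  shows "(W2 \<Omega> \<mu> \<nu>)\<^sup>2 \<le> (\<integral>p. (norm (fst p - snd p))\<^sup>2 \<partial>\<gamma>)"
  unfolding W2_squared[OF assms(1,2)]
  by (rule cINF_lower[OF _ assms(3)]) (auto intro!: bdd_belowI[of _ 0])

lemma W2_geI:
  fixes \<mu> \<nu> :: "'a::euclidean_space measure"
  assumes "\<mu> \<in> borel_probs \<Omega>" "\<nu> \<in> borel_probs \<Omega>"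
    and "\<And>\<gamma>. \<gamma> \<in> couplings \<Omega> \<mu> \<nu> \<Longrightarrow> c \<le> (\<integral>p. (norm (fst p - snd p))\<^sup>2 \<partial>\<gamma>)"
  shows "c \<le> (W2 \<Omega> \<mu> \<nu>)\<^sup>2"
  unfolding W2_squared[OF assms(1,2)] using product_coupling[OF assms(1,2)] assms(3)
  by (intro cINF_greatest) auto

lemma W2_approx_coupling:
  fixes \<mu> \<nu> :: "'a::euclidean_space measure"
  assumes "\<mu> \<in> borel_probs \<Omega>" "\<nu> \<in> borel_probs \<Omega>" "0 < e"
  obtains \<gamma> where "\<gamma> \<in> couplings \<Omega> \<mu> \<nu>"
    and "(\<integral>p. (norm (fst p - snd p))\<^sup>2 \<partial>\<gamma>) < (W2 \<Omega> \<mu> \<nu>)\<^sup>2 + e"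
  using W2_geI[OF assms(1,2), of "(W2 \<Omega> \<mu> \<nu>)\<^sup>2 + e"] assms(3) by (force simp: not_le)

text \<open>Mixing couplings gives a coupling of the mixture, so the squared distance is convex.\<close>

lemma W2_mixture:
  fixes \<mu> \<nu> \<rho> :: "'a::euclidean_space measure"
  assumes \<Omega>: "compact \<Omega>" and \<mu>: "\<mu> \<in> borel_probs \<Omega>" and \<nu>: "\<nu> \<in> borel_probs \<Omega>"
    and \<rho>: "\<rho> \<in> borel_probs \<Omega>" and t: "0 \<le> t" "t \<le> 1"
  shows "(W2 \<Omega> \<mu> (mixture t \<nu> \<rho>))\<^sup>2 \<le> (1 - t) * (W2 \<Omega> \<mu> \<nu>)\<^sup>2 + t * (W2 \<Omega> \<mu> \<rho>)\<^sup>2"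
proof (rule field_le_epsilon)
  fix e :: real assume e: "0 < e"
  let ?d = "\<lambda>p::'a \<times> 'a. (norm (fst p - snd p))\<^sup>2"
  obtain \<gamma> where \<gamma>: "\<gamma> \<in> couplings \<Omega> \<mu> \<nu>" "(\<integral>p. ?d p \<partial>\<gamma>) < (W2 \<Omega> \<mu> \<nu>)\<^sup>2 + e"
    using W2_approx_coupling[OF \<mu> \<nu> e] .
  obtain \<eta> where \<eta>: "\<eta> \<in> couplings \<Omega> \<mu> \<rho>" "(\<integral>p. ?d p \<partial>\<eta>) < (W2 \<Omega> \<mu> \<rho>)\<^sup>2 + e"
    using W2_approx_coupling[OF \<mu> \<rho> e] .
  note \<gamma>' = couplingsD[OF \<gamma>(1)] and \<eta>' = couplingsD[OF \<eta>(1)]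
  have mix: "mixture t \<gamma> \<eta> \<in> couplings \<Omega> \<mu> (mixture t \<nu> \<rho>)"
    using mixture_borel_probs[OF \<gamma>'(1) \<eta>'(1)] mixture_self[OF \<mu>] \<gamma>'(2,3) \<eta>'(2,3)
    by (simp add: couplings_def distr_mixture[OF \<gamma>'(1) \<eta>'(1)]
        measurable_fst_restrict measurable_snd_restrict)
  obtain B where B: "\<And>x y. x \<in> \<Omega> \<Longrightarrow> y \<in> \<Omega> \<Longrightarrow> \<bar>?d (x, y)\<bar> \<le> B"
    using bounded_kernel[OF \<Omega> continuous_sq_dist] by blast
  have "(W2 \<Omega> \<mu> (mixture t \<nu> \<rho>))\<^sup>2 \<le> (\<integral>p. ?d p \<partial>mixture t \<gamma> \<eta>)"
    by (rule W2_le[OF \<mu> mixture_borel_probs[OF \<nu> \<rho>] mix])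
  also have "\<dots> = (1 - t) * (\<integral>p. ?d p \<partial>\<gamma>) + t * (\<integral>p. ?d p \<partial>\<eta>)"
    by (rule integral_mixture[OF \<gamma>'(1) \<eta>'(1) t, where B = B])
      (use B in \<open>auto intro!: borel_measurable_continuous_on_restrict continuous_sq_dist\<close>)
  also have "\<dots> \<le> (1 - t) * ((W2 \<Omega> \<mu> \<nu>)\<^sup>2 + e) + t * ((W2 \<Omega> \<mu> \<rho>)\<^sup>2 + e)"
    using t \<gamma>(2) \<eta>(2) by (intro add_mono mult_left_mono) auto
  finally show "(W2 \<Omega> \<mu> (mixture t \<nu> \<rho>))\<^sup>2
      \<le> (1 - t) * (W2 \<Omega> \<mu> \<nu>)\<^sup>2 + t * (W2 \<Omega> \<mu> \<rho>)\<^sup>2 + e"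
    by (simp add: algebra_simps)
qed

section \<open>The interaction energy\<close>

definition interaction :: "('a \<times> 'a \<Rightarrow> real) \<Rightarrow> 'a measure \<Rightarrow> 'a measure \<Rightarrow> real" where
  "interaction k \<nu> \<rho> = (\<integral>x. (\<integral>y. k (x, y) \<partial>\<rho>) \<partial>\<nu>)"

lemma kernel_integrable_pair:
  fixes k :: "'a::euclidean_space \<times> 'a \<Rightarrow> real"
  assumes "compact \<Omega>" "continuous_on (\<Omega> \<times> \<Omega>) k" "\<nu> \<in> borel_probs \<Omega>" "\<rho> \<in> borel_probs \<Omega>"
  shows "integrable (\<nu> \<Otimes>\<^sub>M \<rho>) k"
proof -
  note \<nu> = borel_probsD[OF assms(3)] and \<rho> = borel_probsD[OF assms(4)]
  interpret P: prob_space "\<nu> \<Otimes>\<^sub>M \<rho>" by (rule prob_space_pair[OF \<nu>(1) \<rho>(1)])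
  obtain B where B: "\<And>x y. x \<in> \<Omega> \<Longrightarrow> y \<in> \<Omega> \<Longrightarrow> \<bar>k (x, y)\<bar> \<le> B"
    using bounded_kernel[OF assms(1,2)] by blast
  have k: "k \<in> borel_measurable (\<nu> \<Otimes>\<^sub>M \<rho>)"
    by (rule pair_measurable[OF assms(2) \<nu>(2) \<rho>(2)])
  show ?thesis
    by (rule P.integrable_const_bound[OF AE_I2 k, of B]) (auto simp: space_pair_measure \<nu> \<rho> B)
qed

lemma integral_pair_eq_interaction:
  fixes k :: "'a::euclidean_space \<times> 'a \<Rightarrow> real"
  assumes "compact \<Omega>" "continuous_on (\<Omega> \<times> \<Omega>) k" "\<nu> \<in> borel_probs \<Omega>" "\<rho> \<in> borel_probs \<Omega>"
  shows "(\<integral>p. k p \<partial>(\<nu> \<Otimes>\<^sub>M \<rho>)) = interaction k \<nu> \<rho>"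
proof -
  interpret M: prob_space \<nu> by (rule borel_probsD[OF assms(3)])
  interpret N: prob_space \<rho> by (rule borel_probsD[OF assms(4)])
  interpret P: pair_prob_space \<nu> \<rho> ..
  show ?thesis
    unfolding interaction_def by (rule P.integral_fst'[symmetric, OF kernel_integrable_pair[OF assms]])
qed

lemma interaction_commute:
  fixes k :: "'a::euclidean_space \<times> 'a \<Rightarrow> real"
  assumes "compact \<Omega>" "continuous_on (\<Omega> \<times> \<Omega>) k" "\<nu> \<in> borel_probs \<Omega>" "\<rho> \<in> borel_probs \<Omega>"
    and sym: "\<And>x y. k (x, y) = k (y, x)"
  shows "interaction k \<nu> \<rho> = interaction k \<rho> \<nu>"
proof -
  interpret M: prob_space \<nu> by (rule borel_probsD[OF assms(3)])
  interpret N: prob_space \<rho> by (rule borel_probsD[OF assms(4)])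
  interpret P: pair_prob_space \<nu> \<rho> ..
  have "integrable (\<nu> \<Otimes>\<^sub>M \<rho>) (case_prod (\<lambda>x y. k (x, y)))"
    using kernel_integrable_pair[OF assms(1-4)] by simp
  from P.Fubini_integral[OF this] show ?thesis
    unfolding interaction_def by (subst (asm) sym) simp
qed

text \<open>The energy is a quadratic form, and symmetry of the kernel merges its two cross terms.\<close>

lemma interaction_mixture:
  fixes k :: "'a::euclidean_space \<times> 'a \<Rightarrow> real"
  assumes \<Omega>: "compact \<Omega>" and k: "continuous_on (\<Omega> \<times> \<Omega>) k" and \<nu>: "\<nu> \<in> borel_probs \<Omega>"
    and \<rho>: "\<rho> \<in> borel_probs \<Omega>" and sym: "\<And>x y. k (x, y) = k (y, x)" and t: "0 \<le> t" "t \<le> 1"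
  shows "interaction k (mixture t \<nu> \<rho>) (mixture t \<nu> \<rho>)
    = (1 - t)\<^sup>2 * interaction k \<nu> \<nu> + 2 * t * (1 - t) * interaction k \<nu> \<rho> + t\<^sup>2 * interaction k \<rho> \<rho>"
proof -
  obtain B where B: "\<And>x y. x \<in> \<Omega> \<Longrightarrow> y \<in> \<Omega> \<Longrightarrow> \<bar>k (x, y)\<bar> \<le> B"
    using bounded_kernel[OF \<Omega> k] by blast
  note mix = mixture_borel_probs[OF \<nu> \<rho>, of t]
  have outer: "interaction k (mixture t \<nu> \<rho>) \<eta>
      = (1 - t) * interaction k \<nu> \<eta> + t * interaction k \<rho> \<eta>" if \<eta>: "\<eta> \<in> borel_probs \<Omega>" for \<eta>
    unfolding interaction_def
    by (rule integral_mixture[OF \<nu> \<rho> t kernel_integral_measurable_bounded(1)[OF \<Omega> k \<eta>]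
          kernel_integral_measurable_bounded(2)[OF \<Omega> k \<eta> B]])
  have inner: "interaction k \<eta> (mixture t \<nu> \<rho>)
      = (1 - t) * interaction k \<nu> \<eta> + t * interaction k \<rho> \<eta>" if \<eta>: "\<eta> \<in> borel_probs \<Omega>" for \<eta>
    using outer[OF \<eta>] interaction_commute[OF \<Omega> k \<eta> mix sym] by simp
  show ?thesis
    unfolding outer[OF mix] inner[OF \<nu>] inner[OF \<rho>] interaction_commute[OF \<Omega> k \<rho> \<nu> sym]
    by (simp add: power2_eq_square algebra_simps)
qed

text \<open>Near \<open>0\<close> the linear term dominates: this is the first-order condition for a minimum at the
  endpoint \<open>t = 0\<close>.\<close>

lemma nonneg_coeff_of_nonneg_quadratic:
  fixes p q :: real
  assumes "\<And>t. 0 < t \<Longrightarrow> t \<le> 1 \<Longrightarrow> 0 \<le> t * p + t\<^sup>2 * q"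
  shows "0 \<le> p"
proof (rule ccontr)
  assume "\<not> 0 \<le> p"
  \<comment> \<open>For this \<open>t\<close> \<open>t * \<bar>q\<bar>\<close> is at most half of \<open>- p\<close>.\<close>
  define t where "t = min 1 (- p / (2 * (\<bar>q\<bar> + 1)))"
  have t: "0 < t" "t \<le> 1"
    using \<open>\<not> 0 \<le> p\<close> by (auto simp: t_def divide_less_0_iff)
  have "t * \<bar>q\<bar> \<le> t * (\<bar>q\<bar> + 1)" using t by simp
  also have "\<dots> \<le> (- p / (2 * (\<bar>q\<bar> + 1))) * (\<bar>q\<bar> + 1)"
    by (intro mult_right_mono) (auto simp: t_def)
  also have "\<dots> = - p / 2" by (simp add: field_simps add_eq_0_iff)
  finally have "p + t * q < 0"
    using \<open>\<not> 0 \<le> p\<close> t mult_left_mono[OF abs_ge_self[of q], of t] by linarith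
  moreover have "t * p + t\<^sup>2 * q = t * (p + t * q)"
    by (simp add: power2_eq_square algebra_simps)
  ultimately show False
    using assms[OF t] t by (simp add: zero_le_mult_iff)
qed

text \<open>Convexity of the transport part and the quadratic expansion of the interaction bound the values
  of the functional along the segment from \<open>\<nu>\<close> to \<open>\<rho>\<close> from above by a
  quadratic polynomial that agrees with it at \<open>\<nu>\<close>. Its slope at \<open>\<nu>\<close> is therefore nonnegative. Since
  the integral of \<open>T_pot V \<nu>\<close> against \<open>\<rho>\<close> is twice the mutual interaction of \<open>\<nu>\<close> and \<open>\<rho>\<close>, this says
  that \<open>\<nu>\<close> also minimizes the functional in which the interaction is replaced by its linearization.\<close>

lemma minimizer_linearized:
  fixes V :: "real \<Rightarrow> real" and \<mu> \<nu> \<rho> :: "'a::euclidean_space measure"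
  assumes \<Omega>: "compact \<Omega>" and V: "continuous_on {0..} V" and \<mu>: "\<mu> \<in> borel_probs \<Omega>"
    and min: "is_arg_min (F_functional \<Omega> V \<mu>) (\<lambda>\<rho>. \<rho> \<in> borel_probs \<Omega>) \<nu>"
    and \<rho>: "\<rho> \<in> borel_probs \<Omega>"
  shows "(W2 \<Omega> \<mu> \<nu>)\<^sup>2 / 2 + (\<integral>x. T_pot V \<nu> x \<partial>\<nu>) \<le> (W2 \<Omega> \<mu> \<rho>)\<^sup>2 / 2 + (\<integral>x. T_pot V \<nu> x \<partial>\<rho>)"
proof -
  let ?k = "\<lambda>p::'a \<times> 'a. V ((norm (fst p - snd p))\<^sup>2)"
  have k: "continuous_on (\<Omega> \<times> \<Omega>) ?k"
    by (rule continuous_on_compose2[OF V continuous_sq_dist]) auto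
  have sym: "?k (x, y) = ?k (y, x)" for x y by (simp add: norm_minus_commute)
  have \<nu>: "\<nu> \<in> borel_probs \<Omega>" using min by (simp add: is_arg_min_def)
  have F: "F_functional \<Omega> V \<mu> \<eta> = (W2 \<Omega> \<mu> \<eta>)\<^sup>2 / 2 + interaction ?k \<eta> \<eta>"
    if "\<eta> \<in> borel_probs \<Omega>" for \<eta>
    unfolding F_functional_def integral_pair_eq_interaction[OF \<Omega> k that that] ..
  have T: "(\<integral>x. T_pot V \<nu> x \<partial>\<eta>) = 2 * interaction ?k \<eta> \<nu>" for \<eta>
    by (simp add: T_pot_def interaction_def)
  \<comment> \<open>The linear and quadratic coefficients in \<open>t\<close> of the upper bound at the mixture with weight \<open>t\<close>.\<close>
  define p where "p = ((W2 \<Omega> \<mu> \<rho>)\<^sup>2 - (W2 \<Omega> \<mu> \<nu>)\<^sup>2) / 2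
    + 2 * (interaction ?k \<nu> \<rho> - interaction ?k \<nu> \<nu>)"
  define q where "q = interaction ?k \<nu> \<nu> - 2 * interaction ?k \<nu> \<rho> + interaction ?k \<rho> \<rho>"
  have "0 \<le> p"
  proof (rule nonneg_coeff_of_nonneg_quadratic[of p q])
    fix t :: real assume t: "0 < t" "t \<le> 1"
    note mix = mixture_borel_probs[OF \<nu> \<rho>, of t]
    have "F_functional \<Omega> V \<mu> \<nu> \<le> F_functional \<Omega> V \<mu> (mixture t \<nu> \<rho>)"
      using min mix by (auto simp: is_arg_min_def not_less)
    also have "\<dots> \<le> ((1 - t) * (W2 \<Omega> \<mu> \<nu>)\<^sup>2 + t * (W2 \<Omega> \<mu> \<rho>)\<^sup>2) / 2
        + ((1 - t)\<^sup>2 * interaction ?k \<nu> \<nu> + 2 * t * (1 - t) * interaction ?k \<nu> \<rho>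
          + t\<^sup>2 * interaction ?k \<rho> \<rho>)"
      unfolding F[OF mix]
      using W2_mixture[OF \<Omega> \<mu> \<nu> \<rho>, of t] interaction_mixture[OF \<Omega> k \<nu> \<rho> sym, of t] t by simp
    also have "\<dots> = F_functional \<Omega> V \<mu> \<nu> + (t * p + t\<^sup>2 * q)"
      unfolding F[OF \<nu>] p_def q_def by (simp add: power2_eq_square field_simps)
    finally show "0 \<le> t * p + t\<^sup>2 * q" by simp
  qed
  then show ?thesis
    unfolding T p_def interaction_commute[OF \<Omega> k \<rho> \<nu> sym] by (simp add: field_simps)
qed

section \<open>Transforms with respect to the quadratic cost\<close>

lemma cost_commute: "cost x y = cost y x"
  by (simp add: cost_def norm_minus_commute)

lemma cost_Lipschitz:
  fixes \<Omega> :: "'a::euclidean_space set"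
  assumes "compact \<Omega>"
  obtains L where "0 \<le> L"
    and "\<And>x y y'. x \<in> \<Omega> \<Longrightarrow> y \<in> \<Omega> \<Longrightarrow> y' \<in> \<Omega> \<Longrightarrow> cost x y \<le> cost x y' + L * dist y y'"
proof -
  obtain R where R: "\<And>x. x \<in> \<Omega> \<Longrightarrow> norm x \<le> R" "0 < R"
    using compact_imp_bounded[OF assms] by (auto simp: bounded_pos)
  show ?thesis
  proof (rule that[of "2 * R"])
    fix x y y' assume *: "x \<in> \<Omega>" "y \<in> \<Omega>" "y' \<in> \<Omega>"
    have "norm (x - y) \<le> 2 * R" "norm (x - y') \<le> 2 * R"
      using R(1)[OF *(1)] R(1)[OF *(2)] R(1)[OF *(3)] norm_triangle_ineq4[of x y]
        norm_triangle_ineq4[of x y'] by linarith+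
    moreover have "norm (x - y) - norm (x - y') \<le> dist y y'"
      using norm_triangle_ineq2[of "x - y" "x - y'"] by (simp add: dist_norm norm_minus_commute)
    ultimately have "(norm (x - y) - norm (x - y')) * (norm (x - y) + norm (x - y'))
        \<le> dist y y' * (4 * R)"
      using R(2) by (intro mult_mono) auto
    then show "cost x y \<le> cost x y' + 2 * R * dist y y'"
      by (simp add: cost_def power2_eq_square algebra_simps)
  qed (use R in simp)
qed

lemma c_transform_lower:
  assumes "ereal (c) = c_transform \<Omega> (\<lambda>x. ereal (f x)) y" and "x \<in> \<Omega>"
  shows "c \<le> cost x y - f x"
proof -
  have "ereal (c) \<le> ereal (cost x y) - ereal (f x)"
    unfolding assms(1) c_transform_def by (rule INF_lower[OF assms(2)])
  then show ?thesis by simp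
qed

lemma c_transform_approx:
  assumes "ereal (c) = c_transform \<Omega> (\<lambda>x. ereal (f x)) y" and "0 < e"
  obtains x where "x \<in> \<Omega>" "cost x y - f x < c + e"
proof -
  have "c_transform \<Omega> (\<lambda>x. ereal (f x)) y < ereal (c + e)"
    using assms by (simp flip: assms(1))
  then show ?thesis
    using that by (auto simp: c_transform_def INF_less_iff)
qed

lemma c_transform_greatest:
  assumes "ereal (c) = c_transform \<Omega> (\<lambda>x. ereal (f x)) y"
    and "\<And>x. x \<in> \<Omega> \<Longrightarrow> a \<le> cost x y - f x"
  shows "a \<le> c"
proof -
  have "ereal a \<le> ereal (c)"
    unfolding assms(1) c_transform_def using assms(2) by (intro INF_greatest) auto
  then show ?thesis by simp
qed

lemma c_transform_finite:
  assumes "\<Omega> \<noteq> {}" and "\<And>x. x \<in> \<Omega> \<Longrightarrow> \<bar>f x\<bar> \<le> B"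
  shows "ereal (real_of_ereal (c_transform \<Omega> (\<lambda>x. ereal (f x)) y)) = c_transform \<Omega> (\<lambda>x. ereal (f x)) y"
proof -
  obtain x where x: "x \<in> \<Omega>" using assms(1) by auto
  have "c_transform \<Omega> (\<lambda>x. ereal (f x)) y \<le> ereal (cost x y - f x)"
    unfolding c_transform_def by (rule INF_lower2[OF x]) simp
  moreover have "ereal (- B) \<le> c_transform \<Omega> (\<lambda>x. ereal (f x)) y"
    unfolding c_transform_def
  proof (rule INF_greatest)
    fix x assume "x \<in> \<Omega>"
    then have "- B \<le> cost x y - f x"
      using assms(2)[of x] zero_le_power2[of "norm (x - y)"] unfolding cost_def by linarith
    then show "ereal (- B) \<le> ereal (cost x y) - ereal (f x)" by simp
  qed
  ultimately show ?thesis by (cases "c_transform \<Omega> (\<lambda>x. ereal (f x)) y") auto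
qed

text \<open>An infimum of functions with a common Lipschitz constant has that constant too. The transformed
  function \<open>u\<close> is allowed to take infinite values, so that the bound covers every real-valued
  \<open>c\<close>-concave function.\<close>

lemma c_transform_Lipschitz:
  assumes L: "\<And>x y y'. x \<in> \<Omega> \<Longrightarrow> y \<in> \<Omega> \<Longrightarrow> y' \<in> \<Omega> \<Longrightarrow> cost x y \<le> cost x y' + L * dist y y'"
    and g: "\<And>y. y \<in> \<Omega> \<Longrightarrow> ereal (g y) = c_transform \<Omega> u y" and y: "y \<in> \<Omega>" "y' \<in> \<Omega>"
  shows "g y \<le> g y' + L * dist y y'"
proof -
  have "ereal (g y - L * dist y y') \<le> c_transform \<Omega> u y'"
    unfolding c_transform_def
  proof (rule INF_greatest)
    fix x assume x: "x \<in> \<Omega>"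
    have "ereal (g y) \<le> ereal (cost x y) - u x"
      unfolding g[OF y(1)] c_transform_def by (rule INF_lower[OF x])
    then show "ereal (g y - L * dist y y') \<le> ereal (cost x y') - u x"
      using L[OF x y] by (cases "u x") auto
  qed
  then have "ereal (g y - L * dist y y') \<le> ereal (g y')" unfolding g[OF y(2)] .
  then show ?thesis by simp
qed

lemma c_concave_continuous:
  fixes g :: "'a::euclidean_space \<Rightarrow> real"
  assumes "compact \<Omega>" and "c_concave \<Omega> (\<lambda>x. ereal (g x))"
  shows "continuous_on \<Omega> g"
proof -
  obtain L where L: "0 \<le> L"
    "\<And>x y y'. x \<in> \<Omega> \<Longrightarrow> y \<in> \<Omega> \<Longrightarrow> y' \<in> \<Omega> \<Longrightarrow> cost x y \<le> cost x y' + L * dist y y'"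
    using cost_Lipschitz[OF assms(1)] by blast
  obtain u where u: "\<And>y. y \<in> \<Omega> \<Longrightarrow> ereal (g y) = c_transform \<Omega> u y"
    using assms(2) by (auto simp: c_concave_def)
  have "L-lipschitz_on \<Omega> g"
  proof (rule lipschitz_onI[OF _ L(1)])
    fix x y assume "x \<in> \<Omega>" "y \<in> \<Omega>"
    then show "dist (g x) (g y) \<le> L * dist x y"
      using c_transform_Lipschitz[OF L(2) u, of x y] c_transform_Lipschitz[OF L(2) u, of y x]
      by (simp add: dist_real_def dist_commute abs_le_iff)
  qed
  then show ?thesis by (rule lipschitz_on_continuous_on)
qed

lemma continuous_c_transform_real:
  fixes f :: "'a::euclidean_space \<Rightarrow> real"
  assumes "compact \<Omega>" "\<Omega> \<noteq> {}" "\<And>x. x \<in> \<Omega> \<Longrightarrow> \<bar>f x\<bar> \<le> B"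
  shows "continuous_on \<Omega> (\<lambda>y. real_of_ereal (c_transform \<Omega> (\<lambda>x. ereal (f x)) y))"
  using c_transform_finite[OF assms(2), of f B] assms(3)
  by (intro c_concave_continuous[OF assms(1)]) (unfold c_concave_def, blast)

lemma integral_marginals:
  fixes \<mu> \<nu> :: "'a::euclidean_space measure" and f g :: "'a \<Rightarrow> real"
  assumes \<Omega>: "compact \<Omega>" and \<gamma>: "\<gamma> \<in> couplings \<Omega> \<mu> \<nu>"
    and f: "continuous_on \<Omega> f" and g: "continuous_on \<Omega> g"
  shows "(\<integral>p. f (fst p) + g (snd p) \<partial>\<gamma>) = (\<integral>x. f x \<partial>\<mu>) + (\<integral>y. g y \<partial>\<nu>)"
    and "integrable \<gamma> (\<lambda>p. f (fst p) + g (snd p))"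
proof -
  note \<gamma>' = couplingsD[OF \<gamma>]
  have meas: "fst \<in> measurable \<gamma> (restrict_space borel \<Omega>)" "snd \<in> measurable \<gamma> (restrict_space borel \<Omega>)"
    using measurable_fst_restrict measurable_snd_restrict borel_probsD(2)[OF \<gamma>'(1)]
    by (auto cong: measurable_cong_sets)
  have "continuous_on (\<Omega> \<times> \<Omega>) (\<lambda>p. f (fst p))" "continuous_on (\<Omega> \<times> \<Omega>) (\<lambda>p. g (snd p))"
    by (auto intro!: continuous_on_compose2[OF f] continuous_on_compose2[OF g] continuous_intros)
  from this[THEN continuous_measurable_integrable(2)[OF \<gamma>'(1) compact_Times[OF \<Omega> \<Omega>]]]
  have int: "integrable \<gamma> (\<lambda>p. f (fst p))" "integrable \<gamma> (\<lambda>p. g (snd p))" .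
  then show "integrable \<gamma> (\<lambda>p. f (fst p) + g (snd p))" by simp
  have "(\<integral>x. f x \<partial>\<mu>) = (\<integral>p. f (fst p) \<partial>\<gamma>)"
    by (subst \<gamma>'(2)[symmetric], rule integral_distr[OF meas(1)])
      (rule borel_measurable_continuous_on_restrict[OF f])
  moreover have "(\<integral>y. g y \<partial>\<nu>) = (\<integral>p. g (snd p) \<partial>\<gamma>)"
    by (subst \<gamma>'(3)[symmetric], rule integral_distr[OF meas(2)])
      (rule borel_measurable_continuous_on_restrict[OF g])
  ultimately show "(\<integral>p. f (fst p) + g (snd p) \<partial>\<gamma>) = (\<integral>x. f x \<partial>\<mu>) + (\<integral>y. g y \<partial>\<nu>)"
    using int by simp
qed

text \<open>Since \<open>\<psi> y + \<psi>\<^sup>c x \<le> c(x, y)\<close>, integrating against a coupling bounds the dual functional by the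
  transport cost. The integrals can be split because \<open>c\<close>-concave functions are continuous on the
  compact set, hence integrable.\<close>

lemma weak_duality:
  fixes \<mu> \<nu> :: "'a::euclidean_space measure" and \<psi> :: "'a \<Rightarrow> real"
  assumes \<Omega>: "compact \<Omega>" "\<Omega> \<noteq> {}" and \<mu>: "\<mu> \<in> borel_probs \<Omega>" and \<nu>: "\<nu> \<in> borel_probs \<Omega>"
    and \<psi>: "c_concave \<Omega> (\<lambda>x. ereal (\<psi> x))"
  shows "dual_functional \<Omega> \<nu> \<mu> \<psi> \<le> (W2 \<Omega> \<mu> \<nu>)\<^sup>2 / 2"
proof -
  note cont = c_concave_continuous[OF \<Omega>(1) \<psi>]
  obtain B where B: "\<And>x. x \<in> \<Omega> \<Longrightarrow> \<bar>\<psi> x\<bar> \<le> B"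
    using continuous_bounded_on[OF \<Omega>(1) cont] by blast
  define h where "h y = real_of_ereal (c_transform \<Omega> (\<lambda>x. ereal (\<psi> x)) y)" for y
  have h: "ereal (h y) = c_transform \<Omega> (\<lambda>x. ereal (\<psi> x)) y" for y
    unfolding h_def by (rule c_transform_finite[OF \<Omega>(2) B])
  have "continuous_on \<Omega> h"
    unfolding h_def by (rule continuous_c_transform_real[OF \<Omega> B])
  note marg = integral_marginals[OF \<Omega>(1) _ this cont]
  have "2 * dual_functional \<Omega> \<nu> \<mu> \<psi> \<le> (W2 \<Omega> \<mu> \<nu>)\<^sup>2"
  proof (rule W2_geI[OF \<mu> \<nu>])
    fix \<gamma> assume \<gamma>: "\<gamma> \<in> couplings \<Omega> \<mu> \<nu>"
    note \<gamma>' = couplingsD(1)[OF \<gamma>]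
    have "2 * dual_functional \<Omega> \<nu> \<mu> \<psi> = (\<integral>p. 2 * (h (fst p) + \<psi> (snd p)) \<partial>\<gamma>)"
      unfolding dual_functional_def h_def[symmetric] integral_mult_right_zero marg(1)[OF \<gamma>] by simp
    also have "\<dots> \<le> (\<integral>p. (norm (fst p - snd p))\<^sup>2 \<partial>\<gamma>)"
    proof (rule integral_mono)
      show "integrable \<gamma> (\<lambda>p. 2 * (h (fst p) + \<psi> (snd p)))"
        using marg(2)[OF \<gamma>] by (rule integrable_mult_right)
      show "integrable \<gamma> (\<lambda>p. (norm (fst p - snd p))\<^sup>2)"
        by (rule continuous_measurable_integrable(2)[OF \<gamma>' compact_Times[OF \<Omega>(1,1)] continuous_sq_dist])
      fix p assume "p \<in> space \<gamma>"
      then have "snd p \<in> \<Omega>" using borel_probsD(3)[OF \<gamma>'] by (simp add: mem_Times_iff)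
      from c_transform_lower[OF h[of "fst p"] this]
      show "2 * (h (fst p) + \<psi> (snd p)) \<le> (norm (fst p - snd p))\<^sup>2"
        by (simp add: cost_def norm_minus_commute)
    qed
    finally show "2 * dual_functional \<Omega> \<nu> \<mu> \<psi> \<le> (\<integral>p. (norm (fst p - snd p))\<^sup>2 \<partial>\<gamma>)" .
  qed
  then show ?thesis by simp
qed

section \<open>Approximately optimal transport maps\<close>

text \<open>An \<open>e\<close>-minimizer in the infimum defining the transform remains a good choice for nearby points,
  because the cost and the transform are Lipschitz. A choice that depends only on the first element
  of a dense sequence that is close to the point is therefore sufficient, and it is measurable
  because it factors through a measurable index with values in the natural numbers.\<close>

lemma measurable_approx_selection:
  fixes \<Omega> :: "'a::euclidean_space set" and f \<phi> :: "'a \<Rightarrow> real"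
  assumes \<Omega>: "compact \<Omega>" "\<Omega> \<noteq> {}"
    and \<phi>: "\<And>x. x \<in> \<Omega> \<Longrightarrow> ereal (\<phi> x) = c_transform \<Omega> (\<lambda>y. ereal (f y)) x" and e: "0 < e"
  obtains s where "s \<in> measurable (restrict_space borel \<Omega>) (restrict_space borel \<Omega>)"
    and "\<And>x. x \<in> \<Omega> \<Longrightarrow> cost (s x) x - f (s x) \<le> \<phi> x + e"
proof -
  obtain L where L: "0 \<le> L"
    "\<And>x y y'. x \<in> \<Omega> \<Longrightarrow> y \<in> \<Omega> \<Longrightarrow> y' \<in> \<Omega> \<Longrightarrow> cost x y \<le> cost x y' + L * dist y y'"
    using cost_Lipschitz[OF \<Omega>(1)] by blast
  \<comment> \<open>Half of the error \<open>e\<close> is spent on the choice at the centre, a quarter each on moving the cost and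
      the transform from the centre to the point.\<close>
  define d where "d = e / (4 * (L + 1))"
  have d: "0 < d" using e L(1) by (simp add: d_def)
  have "L * d \<le> (L + 1) * d" using d by simp
  also have "\<dots> = e / 4" using L(1) by (simp add: d_def divide_simps)
  finally have Ld: "L * d \<le> e / 4" .
  obtain C where C: "countable C" "C \<subseteq> \<Omega>" "\<Omega> \<subseteq> closure C"
    using separable[of \<Omega>] by blast
  have "C \<noteq> {}" using C(3) \<Omega>(2) by auto
  define c where "c = from_nat_into C"
  have c: "c n \<in> \<Omega>" for n
    using from_nat_into[OF \<open>C \<noteq> {}\<close>] C(2) by (auto simp: c_def)
  have ex: "\<exists>n. dist (c n) x < d" if "x \<in> \<Omega>" for x
  proof -
    obtain z where "z \<in> C" "dist z x < d"
      using \<open>x \<in> \<Omega>\<close> C(3) d closure_approachable[of x C] by blast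
    then show ?thesis
      using from_nat_into_surj[OF C(1)] unfolding c_def by metis
  qed
  have "\<exists>y. y \<in> \<Omega> \<and> cost y (c n) - f y < \<phi> (c n) + e / 2" for n
    by (rule c_transform_approx[OF \<phi>[OF c[of n]], of "e / 2"]) (use e in auto)
  then obtain y where y: "\<And>n. y n \<in> \<Omega>" "\<And>n. cost (y n) (c n) - f (y n) < \<phi> (c n) + e / 2"
    by metis
  define N where "N x = (LEAST n. dist (c n) x < d)" for x
  have N: "dist (c (N x)) x < d" if "x \<in> \<Omega>" for x
    unfolding N_def using ex[OF that] by (rule LeastI_ex)
  have "N \<in> measurable borel (count_space UNIV)"
    unfolding N_def by measurable
  then have "(\<lambda>x. y (N x)) \<in> measurable borel borel"
    by (rule measurable_compose) simp
  then have meas: "(\<lambda>x. y (N x)) \<in> measurable (restrict_space borel \<Omega>) (restrict_space borel \<Omega>)"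
    by (rule measurable_restrict_space3) (use y in auto)
  have "cost (y (N x)) x - f (y (N x)) \<le> \<phi> x + e" if x: "x \<in> \<Omega>" for x
  proof -
    have "L * dist (c (N x)) x \<le> L * d"
      using N[OF x] L(1) by (intro mult_left_mono) auto
    moreover have "cost (y (N x)) x \<le> cost (y (N x)) (c (N x)) + L * dist x (c (N x))"
      by (rule L(2)[OF y(1) x c])
    moreover have "\<phi> (c (N x)) \<le> \<phi> x + L * dist (c (N x)) x"
      by (rule c_transform_Lipschitz[OF L(2) \<phi> c x])
    ultimately show ?thesis using y(2)[of "N x"] Ld by (simp add: dist_commute)
  qed
  with meas show ?thesis by (rule that)
qed

text \<open>Without a prescribed target, the sum of the transport cost from \<open>\<mu>\<close> and a linear term is best
  made small pointwise: each \<open>x\<close> is sent to a near-minimizer \<open>y\<close> of \<open>c(x, y) + T y\<close>, whose infimum is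
  \<open>\<phi> x\<close>. The target is the image of \<open>\<mu>\<close> under this map, and the graph of the map carries a coupling.\<close>

lemma approx_optimal_target:
  fixes \<mu> :: "'a::euclidean_space measure" and T \<phi> :: "'a \<Rightarrow> real"
  assumes \<Omega>: "compact \<Omega>" "\<Omega> \<noteq> {}" and \<mu>: "\<mu> \<in> borel_probs \<Omega>"
    and T: "T \<in> borel_measurable (restrict_space borel \<Omega>)" "\<And>x. x \<in> \<Omega> \<Longrightarrow> \<bar>T x\<bar> \<le> B"
    and \<phi>: "\<And>x. x \<in> \<Omega> \<Longrightarrow> ereal (\<phi> x) = c_transform \<Omega> (\<lambda>y. ereal (- T y)) x" and e: "0 < e"
  obtains \<rho> where "\<rho> \<in> borel_probs \<Omega>"
    and "(W2 \<Omega> \<mu> \<rho>)\<^sup>2 / 2 + (\<integral>y. T y \<partial>\<rho>) \<le> (\<integral>x. \<phi> x \<partial>\<mu>) + e"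
proof -
  note \<mu>' = borel_probsD[OF \<mu>]
  interpret prob_space \<mu> by (rule \<mu>')
  obtain s where s: "s \<in> measurable (restrict_space borel \<Omega>) (restrict_space borel \<Omega>)"
    "\<And>x. x \<in> \<Omega> \<Longrightarrow> cost (s x) x - - T (s x) \<le> \<phi> x + e"
    using measurable_approx_selection[OF \<Omega> \<phi> e] by blast
  have s': "s \<in> measurable \<mu> (restrict_space borel \<Omega>)"
    using s(1) \<mu>'(2) by (simp cong: measurable_cong_sets)
  have s\<Omega>: "s x \<in> \<Omega>" if "x \<in> \<Omega>" for x
    using measurable_space[OF s(1), of x] that by (simp add: space_restrict_space)
  define \<rho> where "\<rho> = distr \<mu> (restrict_space borel \<Omega>) s"
  define \<gamma> where "\<gamma> = distr \<mu> (restrict_space borel (\<Omega> \<times> \<Omega>)) (\<lambda>x. (x, s x))"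
  have graph: "(\<lambda>x. (x, s x)) \<in> measurable (restrict_space borel \<Omega>) (restrict_space borel (\<Omega> \<times> \<Omega>))"
    by (rule measurable_compose[OF measurable_Pair[OF measurable_ident s(1)] measurable_id_pair_restrict,
          unfolded id_def])
  then have graph': "(\<lambda>x. (x, s x)) \<in> measurable \<mu> (restrict_space borel (\<Omega> \<times> \<Omega>))"
    using \<mu>'(2) by (simp cong: measurable_cong_sets)
  have \<rho>: "\<rho> \<in> borel_probs \<Omega>" unfolding \<rho>_def by (rule distr_borel_probs[OF \<mu> s(1)])
  have "distr \<mu> (restrict_space borel \<Omega>) (\<lambda>x. x) = \<mu>"
    by (rule distr_id2) (simp add: \<mu>')
  then have \<gamma>: "\<gamma> \<in> couplings \<Omega> \<mu> \<rho>"
    unfolding couplings_def \<gamma>_def \<rho>_def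
    by (simp add: distr_borel_probs[OF \<mu> graph] distr_distr[OF measurable_fst_restrict graph']
        distr_distr[OF measurable_snd_restrict graph'] comp_def)
  have "(W2 \<Omega> \<mu> \<rho>)\<^sup>2 \<le> (\<integral>p. (norm (fst p - snd p))\<^sup>2 \<partial>\<gamma>)"
    by (rule W2_le[OF \<mu> \<rho> \<gamma>])
  also have "\<dots> = (\<integral>x. (norm (x - s x))\<^sup>2 \<partial>\<mu>)"
    unfolding \<gamma>_def
    by (subst integral_distr[OF graph'])
      (auto intro!: borel_measurable_continuous_on_restrict continuous_sq_dist)
  finally have W: "(W2 \<Omega> \<mu> \<rho>)\<^sup>2 / 2 \<le> (\<integral>x. cost (s x) x \<partial>\<mu>)"
    by (simp add: cost_def norm_minus_commute)
  have IT: "(\<integral>y. T y \<partial>\<rho>) = (\<integral>x. T (s x) \<partial>\<mu>)"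
    unfolding \<rho>_def by (rule integral_distr[OF s' T(1)])
  have intT: "integrable \<mu> (\<lambda>x. T (s x))"
    by (rule integrable_const_bound[where B = B, OF AE_I2 measurable_compose[OF s' T(1)]])
      (simp add: \<mu>'(3) T(2) s\<Omega>)
  obtain D where D: "\<And>x y. x \<in> \<Omega> \<Longrightarrow> y \<in> \<Omega> \<Longrightarrow> \<bar>(norm (fst (x, y) - snd (x, y)))\<^sup>2\<bar> \<le> D"
    using bounded_kernel[OF \<Omega>(1) continuous_sq_dist] by blast
  have intc: "integrable \<mu> (\<lambda>x. cost (s x) x)"
  proof (rule integrable_const_bound[of _ "D / 2"])
    show "AE x in \<mu>. norm (cost (s x) x) \<le> D / 2"
      using D s\<Omega> \<mu>'(3) by (auto simp: cost_def)
    show "(\<lambda>x. cost (s x) x) \<in> borel_measurable \<mu>"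
      using measurable_compose[OF graph' borel_measurable_continuous_on_restrict[OF continuous_sq_dist]]
      by (simp add: cost_def norm_minus_commute)
  qed
  have "continuous_on \<Omega> \<phi>"
    using \<phi> by (intro c_concave_continuous[OF \<Omega>(1)]) (unfold c_concave_def, blast)
  note int\<phi> = continuous_measurable_integrable(2)[OF \<mu> \<Omega>(1) this]
  have "(W2 \<Omega> \<mu> \<rho>)\<^sup>2 / 2 + (\<integral>y. T y \<partial>\<rho>) \<le> (\<integral>x. cost (s x) x + T (s x) \<partial>\<mu>)"
    using W intT intc unfolding IT by simp
  also have "\<dots> \<le> (\<integral>x. \<phi> x + e \<partial>\<mu>)"
    using s(2) \<mu>'(3) intT intc int\<phi> by (intro integral_mono) auto
  also have "\<dots> = (\<integral>x. \<phi> x \<partial>\<mu>) + e"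
    using int\<phi> by (simp add: prob_space)
  finally show ?thesis using that[OF \<rho>] by blast
qed

section \<open>Existence of the potential\<close>

theorem theorem3p1:
  fixes \<Omega> U :: "'a::euclidean_space set"
    and V :: "real \<Rightarrow> real"
    and \<mu> \<nu> :: "'a measure"
  assumes "compact \<Omega>"
    and "open U" and "convex U" and "U \<noteq> {}" and "\<Omega> = closure U"
    and "V \<in> {0..} \<rightarrow> {0..}" and "C2_on {0..} V" and "mono_on {0..} V"
    and "\<mu> \<in> borel_probs \<Omega>"
    and "is_arg_min (F_functional \<Omega> V \<mu>) (\<lambda>\<rho>. \<rho> \<in> borel_probs \<Omega>) \<nu>"
  shows "\<exists>\<psi> m. Kantorovich_potential \<Omega> \<nu> \<mu> \<psi> \<and>
           (\<forall>x\<in>\<Omega>. \<psi> x + T_pot V \<nu> x \<ge> m) \<and>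
           (AE x in \<nu>. \<psi> x + T_pot V \<nu> x = m)"
proof -
  note \<Omega> = assms(1) and \<mu> = assms(9) and min = assms(10)
  have ne: "\<Omega> \<noteq> {}" using assms(4,5) closure_subset[of U] by auto
  have V: "continuous_on {0..} V"
    using assms(7) by (auto simp: C2_on_def intro: DERIV_continuous_on)
  have \<nu>: "\<nu> \<in> borel_probs \<Omega>" using min by (simp add: is_arg_min_def)
  note \<nu>' = borel_probsD[OF \<nu>]
  define T where "T = T_pot V \<nu>"
  let ?k = "\<lambda>p::'a \<times> 'a. 2 * V ((norm (fst p - snd p))\<^sup>2)"
  have k: "continuous_on (\<Omega> \<times> \<Omega>) ?k"
    by (intro continuous_on_mult_left continuous_on_compose2[OF V continuous_sq_dist]) auto
  obtain B where B: "\<And>x y. x \<in> \<Omega> \<Longrightarrow> y \<in> \<Omega> \<Longrightarrow> \<bar>?k (x, y)\<bar> \<le> B"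
    using bounded_kernel[OF \<Omega> k] by blast
  have T_eq: "T = (\<lambda>x. \<integral>y. ?k (x, y) \<partial>\<nu>)" by (simp add: T_def T_pot_def fun_eq_iff)
  have T: "T \<in> borel_measurable (restrict_space borel \<Omega>)" "\<And>x. x \<in> \<Omega> \<Longrightarrow> \<bar>T x\<bar> \<le> B"
    unfolding T_eq using kernel_integral_measurable_bounded(1)[OF \<Omega> k \<nu>]
      kernel_integral_measurable_bounded(2)[OF \<Omega> k \<nu> B] by auto
  \<comment> \<open>The potential is the double transform of \<open>- T\<close>. All transforms below are finite because they are
      taken of bounded functions.\<close>
  define \<phi> where "\<phi> x = real_of_ereal (c_transform \<Omega> (\<lambda>y. ereal (- T y)) x)" for x
  have \<phi>: "ereal (\<phi> x) = c_transform \<Omega> (\<lambda>y. ereal (- T y)) x" for x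
    unfolding \<phi>_def by (rule c_transform_finite[OF ne, of _ B]) (use T in auto)
  have \<phi>_cont: "continuous_on \<Omega> \<phi>"
    unfolding \<phi>_def by (rule continuous_c_transform_real[OF \<Omega> ne, of _ B]) (use T in auto)
  obtain B\<phi> where B\<phi>: "\<And>x. x \<in> \<Omega> \<Longrightarrow> \<bar>\<phi> x\<bar> \<le> B\<phi>"
    using continuous_bounded_on[OF \<Omega> \<phi>_cont] by blast
  define \<psi> where "\<psi> y = real_of_ereal (c_transform \<Omega> (\<lambda>x. ereal (\<phi> x)) y)" for y
  have \<psi>: "ereal (\<psi> y) = c_transform \<Omega> (\<lambda>x. ereal (\<phi> x)) y" for y
    unfolding \<psi>_def by (rule c_transform_finite[OF ne B\<phi>])
  have \<psi>_conc: "c_concave \<Omega> (\<lambda>x. ereal (\<psi> x))"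
    using \<psi> unfolding c_concave_def by blast
  have \<psi>_cont: "continuous_on \<Omega> \<psi>" by (rule c_concave_continuous[OF \<Omega> \<psi>_conc])
  obtain B\<psi> where B\<psi>: "\<And>x. x \<in> \<Omega> \<Longrightarrow> \<bar>\<psi> x\<bar> \<le> B\<psi>"
    using continuous_bounded_on[OF \<Omega> \<psi>_cont] by blast
  \<comment> \<open>This is \<open>\<psi>\<^sup>c\<close>, the triple transform of \<open>- T\<close>.\<close>
  define h where "h y = real_of_ereal (c_transform \<Omega> (\<lambda>x. ereal (\<psi> x)) y)" for y
  have h: "ereal (h y) = c_transform \<Omega> (\<lambda>x. ereal (\<psi> x)) y" for y
    unfolding h_def by (rule c_transform_finite[OF ne B\<psi>])
  have h_cont: "continuous_on \<Omega> h"
    unfolding h_def by (rule continuous_c_transform_real[OF \<Omega> ne B\<psi>])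
  have dual: "dual_functional \<Omega> \<nu> \<mu> \<psi> = (\<integral>x. \<psi> x \<partial>\<nu>) + (\<integral>y. h y \<partial>\<mu>)"
    by (simp add: dual_functional_def h_def)
  have \<psi>T: "0 \<le> \<psi> y + T y" if "y \<in> \<Omega>" for y
  proof -
    have "- T y \<le> \<psi> y"
    proof (rule c_transform_greatest[OF \<psi>])
      fix x assume "x \<in> \<Omega>"
      from c_transform_lower[OF \<phi>[of x] that] show "- T y \<le> cost x y - \<phi> x"
        by (simp add: cost_commute)
    qed
    then show ?thesis by simp
  qed
  have h\<phi>: "\<phi> x \<le> h x" if "x \<in> \<Omega>" for x
  proof (rule c_transform_greatest[OF h])
    fix y assume "y \<in> \<Omega>"
    from c_transform_lower[OF \<psi>[of y] that] show "\<phi> x \<le> cost y x - \<psi> y"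
      by (simp add: cost_commute)
  qed
  have opt: "(W2 \<Omega> \<mu> \<nu>)\<^sup>2 / 2 + (\<integral>y. T y \<partial>\<nu>) \<le> (\<integral>x. \<phi> x \<partial>\<mu>)"
  proof (rule field_le_epsilon)
    fix e :: real assume "0 < e"
    then obtain \<rho> where \<rho>: "\<rho> \<in> borel_probs \<Omega>"
      "(W2 \<Omega> \<mu> \<rho>)\<^sup>2 / 2 + (\<integral>y. T y \<partial>\<rho>) \<le> (\<integral>x. \<phi> x \<partial>\<mu>) + e"
      using approx_optimal_target[OF \<Omega> ne \<mu> T \<phi>] by metis
    then show "(W2 \<Omega> \<mu> \<nu>)\<^sup>2 / 2 + (\<integral>y. T y \<partial>\<nu>) \<le> (\<integral>x. \<phi> x \<partial>\<mu>) + e"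
      using minimizer_linearized[OF \<Omega> V \<mu> min \<rho>(1)] unfolding T_def by linarith
  qed
  note int\<mu> = continuous_measurable_integrable(2)[OF \<mu> \<Omega>]
  have le: "(\<integral>x. \<phi> x \<partial>\<mu>) \<le> (\<integral>x. h x \<partial>\<mu>)"
    using h\<phi> borel_probsD(3)[OF \<mu>] by (intro integral_mono int\<mu> \<phi>_cont h_cont) auto
  interpret N: prob_space \<nu> by (rule \<nu>')
  have intT: "integrable \<nu> T"
  proof (rule N.integrable_const_bound[where B = B, OF AE_I2])
    show "T \<in> borel_measurable \<nu>"
      using T(1) \<nu>'(2) by (simp cong: measurable_cong_sets)
  qed (simp add: \<nu>'(3) T(2))
  have int\<psi>: "integrable \<nu> \<psi>" by (rule continuous_measurable_integrable(2)[OF \<nu> \<Omega> \<psi>_cont])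
  have AE0: "AE x in \<nu>. 0 \<le> \<psi> x + T x" using \<psi>T \<nu>'(3) by auto
  have ge0: "0 \<le> (\<integral>x. \<psi> x + T x \<partial>\<nu>)" by (rule integral_nonneg_AE[OF AE0])
  \<comment> \<open>Weak duality bounds the integral of \<open>\<psi>\<close> from above by half the squared distance minus the integral
      of \<open>h\<close>, and the optimality of \<open>\<nu>\<close> bounds the latter from below.\<close>
  have le0: "(\<integral>x. \<psi> x + T x \<partial>\<nu>) \<le> 0"
    using weak_duality[OF \<Omega> ne \<mu> \<nu> \<psi>_conc] opt le intT int\<psi> unfolding dual by simp
  have "AE x in \<nu>. \<psi> x + T x = 0"
    using integral_nonneg_eq_0_iff_AE[OF _ AE0] intT int\<psi> ge0 le0 by auto
  moreover have "Kantorovich_potential \<Omega> \<nu> \<mu> \<psi>"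
  proof -
    have "(W2 \<Omega> \<mu> \<nu>)\<^sup>2 / 2 \<le> dual_functional \<Omega> \<nu> \<mu> \<psi>"
      using opt le ge0 intT int\<psi> unfolding dual by simp
    then show ?thesis
      unfolding Kantorovich_potential_def is_arg_max_def
      using \<psi>_conc weak_duality[OF \<Omega> ne \<mu> \<nu>] by (meson le_less_trans not_less)
  qed
  ultimately show ?thesis
    using \<psi>T unfolding T_def by (intro exI[of _ \<psi>] exI[of _ 0]) auto
qed

end
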